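(* Let $f(x)=\sum_{j=0}^n c_jx^j\in\mathbb{C}[x]$ be monic of degree $n\ge 1$ and let $\alpha\in\mathbb{R}\setminus\mathbb{N}$. Let $D_0^{\alpha}f$ be the Riemann-Liouville fractional derivative (differintegral) of $f$ with base point $0$. Then 1. $M(D_0^{\alpha}f)\ge 2^{-n}\left(1+\frac{|n-\alpha|}{n}\left(\lVert f\rVert_1-1\right)\right)$ whenever $\alpha<0$ or $\alpha>2n$; 2. $M(D_0^{\alpha}f)\le \frac{|n-\alpha|_n}{n!}\lVert f\rVert_1+1$ whenever $\alpha<0$ or $\alpha>n$, where $|n-\alpha|_n=\prod_{k=0}^{n-1}|n-\alpha-k|$; 3. $M(D_0^{\alpha}f)\ge 2^{-n}\binom{n-1}{\lceil (n-1)/2\rceil}^{-1}\frac{\alpha-n}{n}\lVert f\rVert_1$ whenever $n<\alpha<2n$.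
   Context: For $f(x)=\sum_{j=0}^n c_jx^j$ and real $\alpha$, the Riemann-Liouville fractional derivative (differintegral) with base point $0$ is $$D_0^{\alpha}f(x)=\sum_{j=0}^{n} c_j\,\frac{\Gamma(j+1)}{\Gamma(j+1-\alpha)}\,x^{j-\alpha},$$ with the convention $1/\Gamma(s)=0$ for $s\in\{0,-1,-2,\dots\}$, and $x^{j-\alpha}$ computed with the principal branch of the logarithm (for $\alpha<0$ this is the fractional integral of order $-\alpha$). The Mahler measure of $D_0^\alpha f$ is $M(D_0^{\alpha}f)=\prod_{z}\max\{1,|z|\}$, the product over the zeros $z$ of $D_0^{\alpha}f$ counted with multiplicity. Zeros at $0$ contribute a factor $1$; the nonzero zeros and their multiplicities are those of the polynomial $\sum_{j=0}^n c_j\frac{j!}{\Gamma(j+1-\alpha)}x^j=x^{\alpha}D_0^{\alpha}f(x)$. The length of $f$ is $\lVert f\rVert_1=\sum_{j=0}^n|c_j|$. *)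

theory Defs
  imports "HOL-Analysis.Analysis" "HOL-Computational_Algebra.Polynomial"
begin

text \<open>
  Riemann-Liouville differintegral of order \<open>\<alpha>\<close> with base point 0.  The entire function
  \<^const>\<open>rGamma\<close> realises the convention \<open>1 / \<Gamma>(s) = 0\<close> for \<open>s = 0, -1, -2, \<dots>\<close>.  Complex
  \<^term>\<open>(powr)\<close> uses the principal branch; its value 0 at \<open>z = 0\<close> is an artefact, so only
  \<open>z \<noteq> 0\<close> is meaningful.
\<close>
definition RL_deriv :: "real \<Rightarrow> complex poly \<Rightarrow> complex \<Rightarrow> complex" where
  "RL_deriv \<alpha> f z =
     (\<Sum>j\<le>degree f. coeff f j * of_real (Gamma (real j + 1) * rGamma (real j + 1 - \<alpha>))
                     * z powr of_real (real j - \<alpha>))"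

definition RL_poly :: "real \<Rightarrow> complex poly \<Rightarrow> complex poly" where
  "RL_poly \<alpha> f =
     (\<Sum>j\<le>degree f. monom (coeff f j * of_real (fact j * rGamma (real j + 1 - \<alpha>))) j)"

lemma poly_RL_poly:
  assumes "z \<noteq> 0"
  shows "poly (RL_poly \<alpha> f) z = z powr of_real \<alpha> * RL_deriv \<alpha> f z"
proof -
  have *: "z powr of_real \<alpha> * (c * z powr of_real (real j - \<alpha>)) = c * z ^ j" for c j
  proof -
    have "z powr of_real \<alpha> * z powr of_real (real j - \<alpha>) = z powr of_nat j"
      by (simp flip: powr_add)
    then show ?thesis
      using assms by (simp add: powr_nat' mult.left_commute)
  qed
  have "Gamma (real j + 1) = fact j" for j
    by (simp add: Gamma_fact add.commute)
  then show ?thesis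
    unfolding RL_poly_def RL_deriv_def sum_distrib_left *
    by (simp add: poly_sum poly_monom)
qed

text \<open>
  Zeros at 0 would contribute a factor 1 and are left out.  The principal branch makes
  \<^term>\<open>RL_deriv \<alpha> f\<close> discontinuous on the negative real axis in general, so the multiplicity of
  a zero \<open>z \<noteq> 0\<close> is that of \<open>z\<close> as a root of \<open>x\<^sup>\<alpha> D\<^sub>0\<^sup>\<alpha> f(x)\<close>, which is the polynomial
  \<^term>\<open>RL_poly \<alpha> f\<close>.  There is no normalisation by the leading coefficient.
\<close>
definition RL_mahler :: "real \<Rightarrow> complex poly \<Rightarrow> real" where
  "RL_mahler \<alpha> f =
     (\<Prod>z | z \<noteq> 0 \<and> RL_deriv \<alpha> f z = 0. max 1 (cmod z) ^ order z (RL_poly \<alpha> f))"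

definition poly_length :: "complex poly \<Rightarrow> real" where
  "poly_length f = (\<Sum>j\<le>degree f. cmod (coeff f j))"

end

theory Submission
  imports "Berlekamp_Zassenhaus.Mahler_Measure" Defs
begin

text \<open>
  Up to the common nonzero factor \<open>n! / \<Gamma>(n + 1 - \<alpha>)\<close>, the polynomial \<open>x\<^sup>\<alpha> D\<^sub>0\<^sup>\<alpha> f\<close> is monic with
  coefficients \<open>c\<^sub>j \<Prod>\<^bsub>j<k\<le>n\<^esub> (k - \<alpha>) / k\<close>.  The Mahler measure of a monic polynomial is at most its
  length (Landau) and at least \<open>2\<^sup>-\<^sup>n\<close> times its length, so it only remains to bound these products:
  for \<open>\<alpha> < 0\<close> or \<open>\<alpha> > 2n\<close> every factor has modulus at least 1; for \<open>\<alpha> < 0\<close> or \<open>\<alpha> > n\<close> the product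
  over all \<open>0 < k \<le> n\<close> is the largest among \<open>j < n\<close>; for \<open>n < \<alpha> < 2n\<close> one compares \<open>\<alpha> - k\<close>
  with \<open>n - k\<close>, which produces an inverse binomial coefficient.
\<close>

section \<open>Length versus Mahler measure for arbitrary polynomials\<close>

lemma poly_length_eq_sum:
  assumes "degree p \<le> N"
  shows "poly_length p = (\<Sum>j\<le>N. cmod (coeff p j))"
  unfolding poly_length_def using assms
  by (intro sum.mono_neutral_left) (auto simp: not_le coeff_eq_0)

lemma poly_length_monic:
  assumes "lead_coeff f = 1"
  shows "poly_length f = (\<Sum>j<degree f. cmod (coeff f j)) + 1"
  using assms by (simp add: poly_length_def flip: lessThan_Suc_atMost)

text \<open>Multiplying by x only shifts the coefficients, and multiplying by \<open>a\<close>
  scales the length by \<open>cmod a\<close>; the triangle inequality combines the two.\<close>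

lemma poly_length_linear_mult_le: "poly_length ([:- a, 1:] * q) \<le> (1 + cmod a) * poly_length q"
proof -
  let ?N = "degree q"
  have "degree ([:- a, 1:] * q) \<le> Suc ?N"
    using degree_mult_le[of "[:- a, 1:]" q] by simp
  then have "poly_length ([:- a, 1:] * q) = (\<Sum>j\<le>Suc ?N. cmod (coeff ([:- a, 1:] * q) j))"
    by (rule poly_length_eq_sum)
  also have "\<dots> \<le> (\<Sum>j\<le>Suc ?N. cmod (coeff (pCons 0 q) j) + cmod a * cmod (coeff q j))"
    by (intro sum_mono) (auto intro!: order_trans[OF norm_triangle_ineq4] simp: norm_mult)
  also have "\<dots> = (\<Sum>j\<le>Suc ?N. cmod (coeff (pCons 0 q) j)) + cmod a * poly_length q"
    by (simp add: sum.distrib sum_distrib_left poly_length_eq_sum[of q "Suc ?N"]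
             del: sum.atMost_Suc)
  also have "(\<Sum>j\<le>Suc ?N. cmod (coeff (pCons 0 q) j)) = poly_length q"
    by (simp add: sum.atMost_Suc_shift poly_length_def del: sum.atMost_Suc)
  finally show ?thesis
    by (simp add: algebra_simps)
qed

lemma poly_length_smult: "poly_length (smult c p) = cmod c * poly_length p"
  by (cases "c = 0") (simp_all add: poly_length_def norm_mult sum_distrib_left)

text \<open>Since 1 + |a| \<le> 2 max(1, |a|), each linear factor costs one factor 2.\<close>

lemma poly_length_prod_linear_le:
  "poly_length (\<Prod>a\<leftarrow>as. [:- a, 1:]) \<le> 2 ^ length as * (\<Prod>a\<leftarrow>as. max 1 (cmod a))"
proof (induction as)
  case Nil
  show ?case by (simp add: poly_length_def)
next
  case (Cons a as)
  let ?q = "\<Prod>a\<leftarrow>as. [:- a, 1:]"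
  have "poly_length ([:- a, 1:] * ?q) \<le> (1 + cmod a) * poly_length ?q"
    by (rule poly_length_linear_mult_le)
  also have "\<dots> \<le> (2 * max 1 (cmod a)) * (2 ^ length as * (\<Prod>a\<leftarrow>as. max 1 (cmod a)))"
    using Cons by (intro mult_mono) (auto simp: poly_length_def intro!: sum_nonneg)
  finally show ?case
    by (simp add: mult_ac del: mult_pCons_left)
qed

lemma poly_length_le_mahler_measure_poly: "poly_length p \<le> 2 ^ degree p * mahler_measure_poly p"
proof -
  let ?as = "complex_roots_complex p"
  have "poly_length p = poly_length (smult (lead_coeff p) (\<Prod>a\<leftarrow>?as. [:- a, 1:]))"
    by (simp only: complex_roots(1))
  also have "\<dots> \<le> cmod (lead_coeff p) * (2 ^ length ?as * (\<Prod>a\<leftarrow>?as. max 1 (cmod a)))"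
    unfolding poly_length_smult by (intro mult_left_mono poly_length_prod_linear_le) simp
  finally show ?thesis
    by (simp add: mahler_measure_poly_def mult_ac)
qed

text \<open>Landau's inequality bounds the Mahler measure by the l2 norm of the coefficients, which
  is at most their l1 norm.\<close>

lemma mahler_measure_poly_le_poly_length: "mahler_measure_poly p \<le> poly_length p"
proof (cases "p = 0")
  case False
  then have "(\<Sum>a\<leftarrow>coeffs p. (cmod a)\<^sup>2) = (\<Sum>j\<le>degree p. (cmod (coeff p j))\<^sup>2)"
    by (simp add: coeffs_def o_def interv_sum_list_conv_sum_set_nat atLeast0LessThan lessThan_Suc_atMost
             del: upt_Suc)
  then have "l2norm_complex p = L2_set (\<lambda>j. cmod (coeff p j)) {..degree p}"
    by (simp add: L2_set_def)
  then show ?thesis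
    using Landau_inequality[of p] L2_set_le_sum[of "{..degree p}" "\<lambda>j. cmod (coeff p j)"]
    by (simp add: poly_length_def)
qed (simp add: poly_length_def)

section \<open>Mahler measure as a product over distinct roots with multiplicity\<close>

lemma proots_prod_linear: "proots (\<Prod>a\<leftarrow>as. [:- a, 1:]) = mset (as :: 'a :: idom list)"
proof (induction as)
  case (Cons a as)
  have "(\<Prod>a\<leftarrow>as. [:- a, 1:]) \<noteq> 0"
    by auto
  then have "proots ([:- a, 1:] * (\<Prod>a\<leftarrow>as. [:- a, 1:])) = {#a#} + mset as"
    using Cons proots_linear_factor[of "- a"] by (subst proots_mult) auto
  then show ?case
    by simp
qed simp

text \<open>\<open>mahler_measure_poly\<close> runs over a list of roots, \<open>RL_mahler\<close>
  over a set of zeros weighted by \<open>order\<close>; the multiset \<open>proots\<close> links the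
  two.\<close>

lemma mset_complex_roots_complex:
  assumes "p \<noteq> 0"
  shows "mset (complex_roots_complex p) = proots p"
proof -
  have "proots p = proots (smult (lead_coeff p) (\<Prod>a\<leftarrow>complex_roots_complex p. [:- a, 1:]))"
    by (simp only: complex_roots(1))
  also have "\<dots> = mset (complex_roots_complex p)"
    using assms by (simp only: proots_smult leading_coeff_0_iff not_False_eq_True proots_prod_linear)
  finally show ?thesis ..
qed

lemma mahler_measure_poly_eq_prod_order:
  assumes "p \<noteq> 0"
  shows "mahler_measure_poly p =
    cmod (lead_coeff p) * (\<Prod>z | poly p z = 0. max 1 (cmod z) ^ order z p)"
proof -
  have "(\<Prod>a\<leftarrow>complex_roots_complex p. max 1 (cmod a)) = (\<Prod>a\<in>#proots p. max 1 (cmod a))"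
    by (simp only: mset_complex_roots_complex[OF assms, symmetric] prod_mset_prod_list[symmetric] mset_map)
  also have "\<dots> = (\<Prod>z | poly p z = 0. max 1 (cmod z) ^ order z p)"
    using assms by (simp add: image_prod_mset_multiplicity)
  finally show ?thesis
    by (simp add: mahler_measure_poly_def)
qed

section \<open>Transfer of the length bounds to the differintegral\<close>

lemma coeff_RL_poly: "coeff (RL_poly \<alpha> f) j = coeff f j * of_real (fact j * rGamma (real j + 1 - \<alpha>))"
  by (cases "j \<le> degree f") (auto simp: RL_poly_def coeff_sum coeff_eq_0 if_distrib cong: if_cong)

text \<open>Downward induction from \<open>n\<close> with the recurrence rGamma(s) = s rGamma(s +
  1). It also holds at the poles of Gamma, so no case distinction arises.\<close>

lemma fact_rGamma_eq:
  assumes "j \<le> n"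
  shows "fact j * rGamma (real j + 1 - \<alpha>) =
    fact n * rGamma (real n + 1 - \<alpha>) * (\<Prod>k\<in>{j<..n}. (real k - \<alpha>) / real k)"
  using assms
proof (induction rule: inc_induct)
  case (step j)
  have ins: "{j<..n} = insert (Suc j) {Suc j<..n}"
    using step by auto
  have "rGamma (real j + 1 - \<alpha>) = (real (Suc j) - \<alpha>) * rGamma (real (Suc j) + 1 - \<alpha>)"
    using rGamma_plus1[of "real j + 1 - \<alpha>"] by (simp add: algebra_simps)
  moreover have "fact j * (real (Suc j) * x) = fact (Suc j) * x" for x :: real
    by simp
  ultimately have "fact j * rGamma (real j + 1 - \<alpha>) =
      fact (Suc j) * rGamma (real (Suc j) + 1 - \<alpha>) * ((real (Suc j) - \<alpha>) / real (Suc j))"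
    by (simp del: of_nat_Suc)
  also have "\<dots> = fact n * rGamma (real n + 1 - \<alpha>) * (\<Prod>k\<in>{j<..n}. (real k - \<alpha>) / real k)"
    unfolding step.IH ins by (simp add: mult_ac)
  finally show ?case .
qed simp

context
  fixes f :: "complex poly" and n :: nat and \<alpha> :: real
  assumes monic: "lead_coeff f = 1" and deg: "degree f = n" and alpha: "\<alpha> \<notin> \<nat>"
begin

text \<open>A zero of \<open>rGamma\<close> at n + 1 - \<alpha> would make \<alpha> a natural
  number. Hence the leading coefficient survives and the degree stays \<open>n\<close>.\<close>

lemma rGamma_lead_nonzero: "rGamma (real n + 1 - \<alpha>) \<noteq> 0"
proof
  assume "rGamma (real n + 1 - \<alpha>) = 0"
  then obtain m where "real n + 1 - \<alpha> = - real m"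
    by (auto simp: rGamma_eq_zero_iff elim!: nonpos_Ints_cases')
  then have "\<alpha> = real (n + 1 + m)"
    by simp
  with alpha show False
    by (metis of_nat_in_Nats)
qed

lemma degree_RL_poly: "degree (RL_poly \<alpha> f) = n"
proof (rule antisym)
  show "degree (RL_poly \<alpha> f) \<le> n"
    using deg by (intro degree_le) (simp add: coeff_RL_poly coeff_eq_0)
  show "n \<le> degree (RL_poly \<alpha> f)"
    using rGamma_lead_nonzero monic deg by (intro le_degree) (auto simp: coeff_RL_poly)
qed

lemma mahler_measure_RL_poly:
  "mahler_measure_poly (RL_poly \<alpha> f) = fact n * \<bar>rGamma (real n + 1 - \<alpha>)\<bar> * RL_mahler \<alpha> f"
proof -
  let ?g = "RL_poly \<alpha> f"
  have lead: "lead_coeff ?g = of_real (fact n * rGamma (real n + 1 - \<alpha>))"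
    using monic deg by (simp add: degree_RL_poly coeff_RL_poly)
  have "?g \<noteq> 0"
    using lead rGamma_lead_nonzero
    by (metis fact_nonzero leading_coeff_0_iff mult_eq_0_iff of_real_eq_0_iff)
  \<comment> \<open>Away from 0 the factor \<open>z powr of_real \<alpha>\<close> is an exponential,
    hence nonzero.\<close>
  have "{z. z \<noteq> 0 \<and> RL_deriv \<alpha> f z = 0} = {z. poly ?g z = 0} - {0}"
    using poly_RL_poly[of _ \<alpha> f] by (auto simp: powr_def)
  then have "RL_mahler \<alpha> f = (\<Prod>z\<in>{z. poly ?g z = 0} - {0}. max 1 (cmod z) ^ order z ?g)"
    by (simp only: RL_mahler_def)
  \<comment> \<open>A root at 0 may be put back because its factor is a power of max(1, 0) =
    1.\<close>
  also have "\<dots> = (\<Prod>z | poly ?g z = 0. max 1 (cmod z) ^ order z ?g)"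
    using poly_roots_finite[OF \<open>?g \<noteq> 0\<close>] by (intro prod.mono_neutral_left) auto
  finally show ?thesis
    unfolding mahler_measure_poly_eq_prod_order[OF \<open>?g \<noteq> 0\<close>] lead norm_of_real abs_mult by simp
qed

lemma poly_length_RL_poly:
  "poly_length (RL_poly \<alpha> f) = fact n * \<bar>rGamma (real n + 1 - \<alpha>)\<bar> *
    (\<Sum>j\<le>n. cmod (coeff f j) * (\<Prod>k\<in>{j<..n}. \<bar>real k - \<alpha>\<bar> / real k))"
  unfolding poly_length_def degree_RL_poly sum_distrib_left
proof (rule sum.cong)
  fix j assume "j \<in> {..n}"
  then have "\<bar>fact j * rGamma (real j + 1 - \<alpha>)\<bar> =
      fact n * \<bar>rGamma (real n + 1 - \<alpha>)\<bar> * (\<Prod>k\<in>{j<..n}. \<bar>real k - \<alpha>\<bar> / real k)"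
    by (subst fact_rGamma_eq[of j n]) (simp_all add: abs_mult abs_prod)
  then show "cmod (coeff (RL_poly \<alpha> f) j) = fact n * \<bar>rGamma (real n + 1 - \<alpha>)\<bar> *
      (cmod (coeff f j) * (\<Prod>k\<in>{j<..n}. \<bar>real k - \<alpha>\<bar> / real k))"
    unfolding coeff_RL_poly norm_mult norm_of_real by simp
qed simp

text \<open>Mahler measure and length of \<open>RL_poly \<alpha> f\<close> carry the same positive
  factor, the modulus of the leading coefficient, which cancels.\<close>

lemma RL_mahler_bounds:
  defines "S \<equiv> \<Sum>j\<le>n. cmod (coeff f j) * (\<Prod>k\<in>{j<..n}. \<bar>real k - \<alpha>\<bar> / real k)"
  shows "S \<le> 2 ^ n * RL_mahler \<alpha> f" and "RL_mahler \<alpha> f \<le> S"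
proof -
  let ?c = "fact n * \<bar>rGamma (real n + 1 - \<alpha>)\<bar>"
  have c: "?c > 0"
    using rGamma_lead_nonzero by simp
  have "?c * S \<le> ?c * (2 ^ n * RL_mahler \<alpha> f)" "?c * RL_mahler \<alpha> f \<le> ?c * S"
    using poly_length_le_mahler_measure_poly[of "RL_poly \<alpha> f"]
      mahler_measure_poly_le_poly_length[of "RL_poly \<alpha> f"]
    unfolding mahler_measure_RL_poly poly_length_RL_poly degree_RL_poly S_def
    by (simp_all add: mult_ac)
  with c show "S \<le> 2 ^ n * RL_mahler \<alpha> f" "RL_mahler \<alpha> f \<le> S"
    by (simp_all only: mult_le_cancel_left_pos)
qed

end

section \<open>Estimates for the coefficient ratios\<close>

lemma prod_ratio_ge_last:
  assumes "j < n" and "\<alpha> < 0 \<or> \<alpha> > 2 * real n"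
  shows "\<bar>real n - \<alpha>\<bar> / real n \<le> (\<Prod>k\<in>{j<..n}. \<bar>real k - \<alpha>\<bar> / real k)"
proof -
  have "{j<..n} = insert n {j<..<n}"
    using assms by auto
  moreover have "1 \<le> (\<Prod>k\<in>{j<..<n}. \<bar>real k - \<alpha>\<bar> / real k)"
    using assms by (intro prod_ge_1) (auto simp: field_simps)
  ultimately show ?thesis
    using mult_left_mono[of 1 _ "\<bar>real n - \<alpha>\<bar> / real n"] by simp
qed

text \<open>It suffices that the additional factors, those with 0 < k \<le> j, have product at least
  1.\<close>

lemma prod_ratio_le_full:
  assumes "j < n" and "\<alpha> < 0 \<or> \<alpha> > real n"
  shows "(\<Prod>k\<in>{j<..n}. \<bar>real k - \<alpha>\<bar> / real k) \<le> (\<Prod>k\<in>{0<..n}. \<bar>real k - \<alpha>\<bar> / real k)"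
proof -
  have "{0<..n} = {0<..j} \<union> {j<..n}"
    using assms by auto
  then have split: "(\<Prod>k\<in>{0<..n}. \<bar>real k - \<alpha>\<bar> / real k) =
      (\<Prod>k\<in>{0<..j}. \<bar>real k - \<alpha>\<bar> / real k) * (\<Prod>k\<in>{j<..n}. \<bar>real k - \<alpha>\<bar> / real k)"
    by (simp add: prod.union_disjoint)
  have "1 \<le> (\<Prod>k\<in>{0<..j}. \<bar>real k - \<alpha>\<bar> / real k)"
  proof (cases "\<alpha> < 0")
    case True
    then show ?thesis
      by (intro prod_ge_1) (auto simp: field_simps)
  next
    case False
    \<comment> \<open>For \<alpha> > n single factors can be below 1. Reversing the order of the
      denominators repairs this: j + 1 - k \<le> n - k < \<alpha> - k.\<close>
    have "(\<Prod>k\<in>{0<..j}. real k) = (\<Prod>k\<in>{0<..j}. real (Suc j - k))"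
      by (rule prod.reindex_bij_witness[of _ "\<lambda>k. Suc j - k" "\<lambda>k. Suc j - k"]) auto
    also have "\<dots> \<le> (\<Prod>k\<in>{0<..j}. \<bar>real k - \<alpha>\<bar>)"
      using assms False by (intro prod_mono) auto
    moreover have "0 < (\<Prod>k\<in>{0<..j}. real k)"
      by (intro prod_pos) auto
    ultimately show ?thesis
      by (simp add: prod_dividef)
  qed
  then have "1 * (\<Prod>k\<in>{j<..n}. \<bar>real k - \<alpha>\<bar> / real k) \<le> (\<Prod>k\<in>{0<..n}. \<bar>real k - \<alpha>\<bar> / real k)"
    unfolding split by (intro mult_right_mono prod_nonneg) auto
  then show ?thesis
    by simp
qed

lemma prod_ratio_full:
  "(\<Prod>k\<in>{0<..n}. \<bar>real k - \<alpha>\<bar> / real k) = (\<Prod>k=0..<n. \<bar>real n - \<alpha> - real k\<bar>) / fact n"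
proof -
  have "(\<Prod>k\<in>{0<..n}. \<bar>real k - \<alpha>\<bar>) = (\<Prod>k=0..<n. \<bar>real n - \<alpha> - real k\<bar>)"
    by (rule prod.reindex_bij_witness[of _ "\<lambda>k. n - k" "\<lambda>k. n - k"]) (auto simp: of_nat_diff algebra_simps)
  moreover have "(\<Prod>k\<in>{0<..n}. real k) = fact n"
    by (simp add: fact_prod flip: atLeastSucAtMost_greaterThanAtMost)
  ultimately show ?thesis
    by (simp add: prod_dividef)
qed

text \<open>This is the boundary case \<alpha> = m + 1 of the ratios; the product telescopes to j!
  (m - j)! / m!.\<close>

lemma prod_ratio_binomial:
  assumes "j \<le> m"
  shows "(\<Prod>k\<in>{j<..m}. (real m + 1 - real k) / real k) = 1 / real (m choose j)"
  using assms
proof (induction rule: inc_induct)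
  case (step j)
  have ins: "{j<..m} = insert (Suc j) {Suc j<..m}"
    using step by auto
  have absorb: "real (Suc j) * real (m choose Suc j) = (real m - real j) * real (m choose j)"
    using arg_cong[OF trans[OF binomial_absorption binomial_absorb_comp[symmetric]], of real j m] step.hyps
    by (simp only: of_nat_mult of_nat_diff less_imp_le)
  have "(\<Prod>k\<in>{j<..m}. (real m + 1 - real k) / real k) =
      (real m - real j) / (real (Suc j) * real (m choose Suc j))"
    unfolding ins using step.IH by (simp add: algebra_simps)
  also have "\<dots> = 1 / real (m choose j)"
    unfolding absorb using step by simp
  finally show ?case .
qed simp

lemma nat_ceiling_half: "nat \<lceil>real m / 2\<rceil> = m - m div 2"
  by linarith

lemma prod_ratio_ge_binomial:
  assumes "j \<le> n" "1 \<le> n" "real n < \<alpha>" "\<alpha> < 2 * real n"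
  shows "1 / real ((n - 1) choose nat \<lceil>(real n - 1) / 2\<rceil>) * ((\<alpha> - real n) / real n)
    \<le> (\<Prod>k\<in>{j<..n}. \<bar>real k - \<alpha>\<bar> / real k)"
proof -
  obtain m where n: "n = Suc m"
    using assms by (cases n) auto
  define B where "B = m choose nat \<lceil>(real n - 1) / 2\<rceil>"
  have eq_B: "(n - 1) choose nat \<lceil>(real n - 1) / 2\<rceil> = B"
    by (simp add: B_def n)
  \<comment> \<open>The rounded-up half is the complement of \<open>m div 2\<close> in
    \<open>m\<close>, so \<open>B\<close> is the central, largest entry of its row.\<close>
  have "B = m choose (m div 2)"
    using binomial_symmetric[of "m div 2" m] by (simp add: B_def n nat_ceiling_half)
  then have max: "m choose i \<le> B" for i
    by (simp add: binomial_maximum)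
  have pos: "0 < B"
    using max[of 0] by simp
  show ?thesis
  proof (cases "j = n")
    case True
    \<comment> \<open>The product is empty here, so the left side must be at most 1; this is where
      \<alpha> < 2n enters.\<close>
    have "1 / real B \<le> 1"
      using pos by simp
    moreover have "(\<alpha> - real n) / real n \<le> 1"
      using assms by (simp add: field_simps)
    ultimately have "1 / real B * ((\<alpha> - real n) / real n) \<le> 1 * 1"
      using assms by (intro mult_mono) auto
    then show ?thesis
      unfolding eq_B using True by simp
  next
    case False
    then have "j \<le> m"
      using assms n by simp
    have "1 / real B \<le> 1 / real (m choose j)"
      using max[of j] \<open>j \<le> m\<close> pos by (intro divide_left_mono) auto
    also have "\<dots> = (\<Prod>k\<in>{j<..m}. (real m + 1 - real k) / real k)"
      using prod_ratio_binomial[OF \<open>j \<le> m\<close>] by simp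
    \<comment> \<open>Factorwise, \<alpha> - k > n - k = m + 1 - k. The factor k = n is kept apart,
      as this comparison would give only 0 for it.\<close>
    also have "\<dots> \<le> (\<Prod>k\<in>{j<..m}. \<bar>real k - \<alpha>\<bar> / real k)"
      using assms n by (intro prod_mono) (auto intro!: divide_right_mono)
    finally have "1 / real B * ((\<alpha> - real n) / real n) \<le>
        (\<Prod>k\<in>{j<..m}. \<bar>real k - \<alpha>\<bar> / real k) * ((\<alpha> - real n) / real n)"
      using assms by (intro mult_right_mono) auto
    also have "\<dots> = (\<Prod>k\<in>{j<..n}. \<bar>real k - \<alpha>\<bar> / real k)"
    proof -
      have "{j<..n} = insert n {j<..m}"
        using \<open>j \<le> m\<close> n by auto
      then show ?thesis
        using assms n by (simp add: mult.commute)
    qed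
    finally show ?thesis
      unfolding eq_B .
  qed
qed

theorem theorem5p4:
  fixes f :: "complex poly" and n :: nat and \<alpha> :: real
  assumes "lead_coeff f = 1" and "degree f = n" and "n \<ge> 1" and "\<alpha> \<notin> \<nat>"
  shows "(\<alpha> < 0 \<or> \<alpha> > 2 * real n \<longrightarrow>
            RL_mahler \<alpha> f \<ge> 1 / 2 ^ n * (1 + \<bar>real n - \<alpha>\<bar> / real n * (poly_length f - 1)))
       \<and> (\<alpha> < 0 \<or> \<alpha> > real n \<longrightarrow>
            RL_mahler \<alpha> f \<le> (\<Prod>k=0..<n. \<bar>real n - \<alpha> - real k\<bar>) / fact n * poly_length f + 1)
       \<and> (real n < \<alpha> \<and> \<alpha> < 2 * real n \<longrightarrow>
            RL_mahler \<alpha> f \<ge> 1 / 2 ^ n * (1 / real ((n - 1) choose nat \<lceil>(real n - 1) / 2\<rceil>))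
                              * ((\<alpha> - real n) / real n) * poly_length f)"
proof -
  let ?w = "\<lambda>j. \<Prod>k\<in>{j<..n}. \<bar>real k - \<alpha>\<bar> / real k"
  let ?S = "\<Sum>j\<le>n. cmod (coeff f j) * ?w j"
  note bounds = RL_mahler_bounds[OF assms(1,2,4)]
  note length = poly_length_monic[OF assms(1), unfolded assms(2)]
  \<comment> \<open>The leading term has coefficient 1 and an empty product as weight.\<close>
  have S: "?S = (\<Sum>j<n. cmod (coeff f j) * ?w j) + 1"
    using assms by (simp flip: lessThan_Suc_atMost)
  have "1 / 2 ^ n * (1 + \<bar>real n - \<alpha>\<bar> / real n * (poly_length f - 1)) \<le> RL_mahler \<alpha> f"
    if "\<alpha> < 0 \<or> \<alpha> > 2 * real n"
  proof -
    have "\<bar>real n - \<alpha>\<bar> / real n * (poly_length f - 1) =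
        (\<Sum>j<n. cmod (coeff f j) * (\<bar>real n - \<alpha>\<bar> / real n))"
      by (simp add: length sum_distrib_left sum_divide_distrib mult_ac)
    also have "\<dots> \<le> (\<Sum>j<n. cmod (coeff f j) * ?w j)"
      using prod_ratio_ge_last[OF _ that] by (intro sum_mono mult_left_mono) auto
    finally have "1 + \<bar>real n - \<alpha>\<bar> / real n * (poly_length f - 1) \<le> 2 ^ n * RL_mahler \<alpha> f"
      using bounds(1) S by linarith
    then show ?thesis
      by (simp add: field_simps)
  qed
  moreover have "RL_mahler \<alpha> f \<le> (\<Prod>k=0..<n. \<bar>real n - \<alpha> - real k\<bar>) / fact n * poly_length f + 1"
    if "\<alpha> < 0 \<or> \<alpha> > real n"
  proof -
    have "(\<Sum>j<n. cmod (coeff f j) * ?w j) \<le> (\<Sum>j<n. cmod (coeff f j) * ?w 0)"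
      using prod_ratio_le_full[OF _ that] by (intro sum_mono mult_left_mono) auto
    also have "\<dots> = ?w 0 * (poly_length f - 1)"
      by (simp add: length mult.commute flip: sum_distrib_right)
    \<comment> \<open>The stated upper bound has the full length, so the -1 is given away.\<close>
    also have "\<dots> \<le> ?w 0 * poly_length f"
      by (intro mult_left_mono prod_nonneg) auto
    finally show ?thesis
      using bounds(2) S unfolding prod_ratio_full by linarith
  qed
  moreover have "1 / 2 ^ n * (1 / real ((n - 1) choose nat \<lceil>(real n - 1) / 2\<rceil>))
      * ((\<alpha> - real n) / real n) * poly_length f \<le> RL_mahler \<alpha> f"
    if "real n < \<alpha>" "\<alpha> < 2 * real n"
  proof -
    let ?b = "1 / real ((n - 1) choose nat \<lceil>(real n - 1) / 2\<rceil>) * ((\<alpha> - real n) / real n)"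
    have "?b * poly_length f = (\<Sum>j\<le>n. cmod (coeff f j) * ?b)"
      unfolding poly_length_def assms(2) sum_distrib_left by (simp only: mult.commute)
    \<comment> \<open>Here the leading term is compared as well, with weight 1, because the bound
      involves the full length.\<close>
    also have "\<dots> \<le> ?S"
      using prod_ratio_ge_binomial[OF _ assms(3) that] by (intro sum_mono mult_left_mono) auto
    finally have "?b * poly_length f \<le> 2 ^ n * RL_mahler \<alpha> f"
      using bounds(1) by linarith
    then have "1 / 2 ^ n * (?b * poly_length f) \<le> 1 / 2 ^ n * (2 ^ n * RL_mahler \<alpha> f)"
      by (rule mult_left_mono) simp
    then show ?thesis
      by (simp add: mult.assoc)
  qed
  ultimately show ?thesis
    by blast
qed

end
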